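(* Let $B=(\beta_1,\beta_2,\dots,\beta_p)$ be a simple Parry alternate base satisfying the weight property. Then $B$ has Property (F).
   Context: $\mathbb{N}$ contains $0$. An alternate base with period $p\ge 1$, written $B=(\beta_1,\dots,\beta_p)$, is a purely periodic sequence $(\beta_n)_{n\ge1}$ of real numbers $\beta_n>1$ with $\beta_{n+p}=\beta_n$ for all $n$. For $k\ge1$, $B^{(k)}=(\beta_n)_{n\ge k}$ is the shifted base. For a sequence $\mathbf{x}=x_1x_2\cdots$ of integers, $\mathrm{val}\,\mathbf{x}=\sum_{n\ge1}x_n/(\beta_1\cdots\beta_n)$. Greedy expansion: for $x\in[0,1]$ put $x_1=\lfloor\beta_1x\rfloor$, $r_1=\beta_1x-x_1$, and for $n\ge2$ put $x_n=\lfloor\beta_nr_{n-1}\rfloor$, $r_n=\beta_nr_{n-1}-x_n$; the sequence $d_B(x)=x_1x_2x_3\cdots$ is the $B$-expansion of $x$ (in particular this defines $d_B(1)$). The expansion $d_{B^{(k)}}$ is defined in the same way using $B^{(k)}$. Write $\mathbf{t}^{(\ell)}=t_1^{(\ell)}t_2^{(\ell)}\cdots=d_{B^{(\ell)}}(1)$. $\mathcal{F}$ is the set of sequences $(x_n)_{n\ge1}$ of non-negative integers with only finitely many nonzero terms, and $\mathrm{Fin}(B)=\{x\in[0,1): d_B(x)\in\mathcal{F}\}$. Property (F): for all $x,y\in\mathrm{Fin}(B)$, $x+y\in[0,1)$ implies $x+y\in\mathrm{Fin}(B)$, and $x-y\in[0,1)$ implies $x-y\in\mathrm{Fin}(B)$.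 $B$ is a simple Parry alternate base if $\mathbf{t}^{(\ell)}\in\mathcal{F}$ for every $\ell\in\{1,\dots,p\}$. Notation for words: $0^k$ is a block of $k$ zeros, $0^\omega$ an infinite tail of zeros, juxtaposition is concatenation, $\succ_{lex}$ is the strict lexicographic order on sequences. Rewriting property: let $$\mathcal{S}=\left\{0^{p+\ell-1}t_1^{(\ell)}\cdots t_{k-1}^{(\ell)}(t_k^{(\ell)}+1)0^\omega:\ 1\le\ell\le p,\ k\ge1\right\}\cup\left\{0^{p+\ell-1}\mathbf{t}^{(\ell)}:\ 1\le\ell\le p,\ 0^{p+\ell-1}\mathbf{t}^{(\ell)}\in\mathcal{F}\right\}.$$ $B$ has the rewriting property if for every $\mathbf{a}\in\mathcal{S}$ there is a string $T(\mathbf{a})$ such that $T(\mathbf{a})\in\mathcal{F}$, $\mathrm{val}\,T(\mathbf{a})=\mathrm{val}\,\mathbf{a}$ and $T(\mathbf{a})\succ_{lex}\mathbf{a}$. Weight property: $B$ has the weight property if it has the rewriting property (with some choice of rewritings $T(\mathbf{a})$, $\mathbf{a}\in\mathcal{S}$) and, moreover, there exist positive integers $w_n$, $n\ge1$, such that the weight function $g:\mathcal{F}\to\mathbb{N}$, $g(\mathbf{a})=\sum_{n\ge1}w_na_n$, satisfies (1) $g(0^p\mathbf{a})=g(\mathbf{a})$ for every $\mathbf{a}\in\mathcal{F}$, and (2) $g(\mathbf{a})\ge g(T(\mathbf{a}))$ for every $\mathbf{a}\in\mathcal{S}$. *)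

theory Defs
  imports "HOL-Analysis.Analysis" "HOL-Library.Fun_Lexorder"
begin

text \<open>
  All sequences are functions on \<^typ>\<open>nat\<close> starting at index 0: \<open>\<beta> n\<close> stands for
  \<open>\<beta>\<^sub>n\<^sub>+\<^sub>1\<close>, \<open>x n\<close> for the digit \<open>x\<^sub>n\<^sub>+\<^sub>1\<close>, and the shift index \<open>l\<close> and the cut position \<open>k\<close>
  are likewise one less than in the usual 1-based notation. In particular \<open>shift l \<beta>\<close> is the
  base written \<open>B\<^sup>(\<^sup>l\<^sup>+\<^sup>1\<^sup>)\<close>.
\<close>

definition alternate_base :: "nat \<Rightarrow> (nat \<Rightarrow> real) \<Rightarrow> bool" where
  "alternate_base p \<beta> \<longleftrightarrow> p \<ge> 1 \<and> (\<forall>n. \<beta> n > 1) \<and> (\<forall>n. \<beta> (n + p) = \<beta> n)"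

definition shift :: "nat \<Rightarrow> (nat \<Rightarrow> 'a) \<Rightarrow> nat \<Rightarrow> 'a" where
  "shift l x = (\<lambda>n. x (l + n))"

definition val :: "(nat \<Rightarrow> real) \<Rightarrow> (nat \<Rightarrow> int) \<Rightarrow> real" where
  "val \<beta> x = (\<Sum>n. real_of_int (x n) / (\<Prod>i\<le>n. \<beta> i))"

text \<open>\<open>remainder \<beta> x n\<close> is \<open>r\<^sub>n\<close>, with the convention \<open>r\<^sub>0 = x\<close>, so here the index is not shifted.\<close>

primrec remainder :: "(nat \<Rightarrow> real) \<Rightarrow> real \<Rightarrow> nat \<Rightarrow> real" where
  "remainder \<beta> x 0 = x"
| "remainder \<beta> x (Suc n) = \<beta> n * remainder \<beta> x n - real_of_int \<lfloor>\<beta> n * remainder \<beta> x n\<rfloor>"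

definition expansion :: "(nat \<Rightarrow> real) \<Rightarrow> real \<Rightarrow> nat \<Rightarrow> int" where
  "expansion \<beta> x = (\<lambda>n. \<lfloor>\<beta> n * remainder \<beta> x n\<rfloor>)"

definition expansion_one :: "(nat \<Rightarrow> real) \<Rightarrow> nat \<Rightarrow> nat \<Rightarrow> int" where
  "expansion_one \<beta> l = expansion (shift l \<beta>) 1"

definition finite_seqs :: "(nat \<Rightarrow> int) set" where
  "finite_seqs = {x. (\<forall>n. x n \<ge> 0) \<and> finite {n. x n \<noteq> 0}}"

definition Fin :: "(nat \<Rightarrow> real) \<Rightarrow> real set" where
  "Fin \<beta> = {x \<in> {0..<1}. expansion \<beta> x \<in> finite_seqs}"

definition property_F :: "(nat \<Rightarrow> real) \<Rightarrow> bool" where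
  "property_F \<beta> \<longleftrightarrow> (\<forall>x \<in> Fin \<beta>. \<forall>y \<in> Fin \<beta>.
     (x + y \<in> {0..<1} \<longrightarrow> x + y \<in> Fin \<beta>) \<and> (x - y \<in> {0..<1} \<longrightarrow> x - y \<in> Fin \<beta>))"

definition simple_parry :: "nat \<Rightarrow> (nat \<Rightarrow> real) \<Rightarrow> bool" where
  "simple_parry p \<beta> \<longleftrightarrow> (\<forall>l<p. expansion_one \<beta> l \<in> finite_seqs)"

text \<open>\<open>prepend_zeros m x\<close> is the sequence \<open>0\<^sup>m x\<close>.\<close>

definition prepend_zeros :: "nat \<Rightarrow> (nat \<Rightarrow> int) \<Rightarrow> nat \<Rightarrow> int" where
  "prepend_zeros m x = (\<lambda>n. if n < m then 0 else x (n - m))"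

text \<open>\<open>cut_incr k x\<close> is \<open>x\<^sub>1 \<dots> x\<^sub>k (x\<^sub>k\<^sub>+\<^sub>1 + 1) 0 0 0 \<dots>\<close> in 1-based notation.\<close>

definition cut_incr :: "nat \<Rightarrow> (nat \<Rightarrow> int) \<Rightarrow> nat \<Rightarrow> int" where
  "cut_incr k x = (\<lambda>n. if n < k then x n else if n = k then x k + 1 else 0)"

definition rewritable :: "nat \<Rightarrow> (nat \<Rightarrow> real) \<Rightarrow> (nat \<Rightarrow> int) set" where
  "rewritable p \<beta> =
     {prepend_zeros (p + l) (cut_incr k (expansion_one \<beta> l)) | l k. l < p} \<union>
     {prepend_zeros (p + l) (expansion_one \<beta> l) | l.
        l < p \<and> prepend_zeros (p + l) (expansion_one \<beta> l) \<in> finite_seqs}"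

text \<open>\<open>less_fun\<close> from the library is the strict lexicographic order on sequences.\<close>

definition rewriting :: "nat \<Rightarrow> (nat \<Rightarrow> real) \<Rightarrow> ((nat \<Rightarrow> int) \<Rightarrow> (nat \<Rightarrow> int)) \<Rightarrow> bool" where
  "rewriting p \<beta> T \<longleftrightarrow> (\<forall>a \<in> rewritable p \<beta>.
     T a \<in> finite_seqs \<and> val \<beta> (T a) = val \<beta> a \<and> less_fun a (T a))"

definition weight :: "(nat \<Rightarrow> nat) \<Rightarrow> (nat \<Rightarrow> int) \<Rightarrow> int" where
  "weight w a = (\<Sum>n | a n \<noteq> 0. int (w n) * a n)"

definition weight_property :: "nat \<Rightarrow> (nat \<Rightarrow> real) \<Rightarrow> bool" where
  "weight_property p \<beta> \<longleftrightarrow> (\<exists>T w. rewriting p \<beta> T \<and> (\<forall>n. w n > 0) \<and>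
     (\<forall>a \<in> finite_seqs. weight w (prepend_zeros p a) = weight w a) \<and>
     (\<forall>a \<in> rewritable p \<beta>. weight w a \<ge> weight w (T a)))"

end

theory Submission
  imports Defs
begin

text \<open>
  The point is that, under the weight property, every number below 1 that has any finite
  representation with nonnegative digits has a finite greedy expansion
  (\<open>representable_imp_Fin\<close>). A representation that is not greedy has a tail of value at least 1;
  the last such tail dominates some string of \<open>rewritable\<close> (\<open>tail_ge_expansion_one\<close>), so a rewriting
  applies and yields a representation of the same number that is lexicographically larger and has
  no larger weight (\<open>rewriting_step\<close>). This cannot go on for ever, because the weights are
  positive: a nonempty set of finite sequences of bounded weight has a lexicographically maximal element
  (\<open>bounded_weight_has_lex_maximal\<close>). A maximal representation is therefore greedy.

  It remains to represent sums and differences. For sums the digits are added. For differences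
  one subtracts the greedy expansions digit by digit and borrows a unit where the digits first
  differ; as subtraction goes on to the right, the unit is written out again by means of the
  expansion of 1 in the shifted base, which is finite because the base is simple Parry (\<open>representable_diff\<close>).
\<close>

section \<open>Finite digit sequences and their values\<close>

lemma finite_seqs_bound:
  assumes "c \<in> finite_seqs"
  obtains N where "\<And>n. n \<ge> N \<Longrightarrow> c n = 0"
proof -
  have "finite {n. c n \<noteq> 0}"
    using assms by (simp add: finite_seqs_def)
  then obtain N where "\<forall>n\<in>{n. c n \<noteq> 0}. n < N"
    by (meson finite_nat_set_iff_bounded)
  then show ?thesis
    using that[of N] by (meson linorder_not_less mem_Collect_eq)
qed

lemma finite_seqsI:
  assumes "\<And>n. c n \<ge> 0" "\<And>n. n \<ge> N \<Longrightarrow> c n = 0"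
  shows "c \<in> finite_seqs"
proof -
  have "{n. c n \<noteq> 0} \<subseteq> {..<N}"
    using assms(2) not_le_imp_less by blast
  then show ?thesis
    using assms(1) finite_subset by (auto simp: finite_seqs_def)
qed

lemma finite_seqs_nonneg: "c \<in> finite_seqs \<Longrightarrow> c n \<ge> 0"
  by (simp add: finite_seqs_def)

lemma finite_seqs_shift:
  assumes "c \<in> finite_seqs"
  shows "shift l c \<in> finite_seqs"
proof -
  obtain N where "\<And>n. n \<ge> N \<Longrightarrow> c n = 0"
    using finite_seqs_bound[OF assms] by blast
  then show ?thesis
    using assms by (intro finite_seqsI[of _ N]) (auto simp: shift_def finite_seqs_nonneg)
qed

lemma finite_seqs_prepend_zeros:
  assumes "c \<in> finite_seqs"
  shows "prepend_zeros m c \<in> finite_seqs"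
proof -
  obtain N where "\<And>n. n \<ge> N \<Longrightarrow> c n = 0"
    using finite_seqs_bound[OF assms] by blast
  then show ?thesis
    using assms by (intro finite_seqsI[of _ "N + m"]) (auto simp: prepend_zeros_def finite_seqs_nonneg)
qed

lemma finite_seqs_add:
  assumes "a \<in> finite_seqs" "b \<in> finite_seqs"
  shows "(\<lambda>n. a n + b n) \<in> finite_seqs"
proof -
  obtain N where "\<And>n. n \<ge> N \<Longrightarrow> a n = 0"
    using finite_seqs_bound[OF assms(1)] by blast
  moreover obtain M where "\<And>n. n \<ge> M \<Longrightarrow> b n = 0"
    using finite_seqs_bound[OF assms(2)] by blast
  ultimately show ?thesis
    using assms by (intro finite_seqsI[of _ "max N M"]) (auto simp: finite_seqs_nonneg)
qed

lemma finite_seqs_diff: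
  assumes "a \<in> finite_seqs" "b \<in> finite_seqs" "\<And>n. b n \<le> a n"
  shows "(\<lambda>n. a n - b n) \<in> finite_seqs"
proof -
  obtain N where "\<And>n. n \<ge> N \<Longrightarrow> a n = 0"
    using finite_seqs_bound[OF assms(1)] by blast
  then have "a n - b n = 0" if "n \<ge> N" for n
    using that assms(3)[of n] finite_seqs_nonneg[OF assms(2), of n] by force
  then show ?thesis
    using assms(3) by (intro finite_seqsI[of _ N]) auto
qed

lemma shift_shift: "shift k (shift l x) = shift (l + k) x"
  by (simp add: shift_def add.assoc)

lemma shift_0 [simp]: "shift 0 x = x"
  by (simp add: shift_def)

lemma prepend_zeros_0 [simp]: "prepend_zeros 0 x = x"
  by (simp add: prepend_zeros_def)

lemma prepend_zeros_add: "prepend_zeros m (prepend_zeros k x) = prepend_zeros (m + k) x"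
  by (auto simp: prepend_zeros_def fun_eq_iff)

lemma shift_prepend_zeros: "shift m (prepend_zeros m x) = x"
  by (auto simp: prepend_zeros_def shift_def)

lemma val_eq_sum:
  assumes "\<And>n. n \<ge> N \<Longrightarrow> c n = 0"
  shows "val \<beta> c = (\<Sum>n<N. real_of_int (c n) / (\<Prod>i\<le>n. \<beta> i))"
  unfolding val_def using assms by (intro suminf_finite) auto

lemma val_add:
  assumes "a \<in> finite_seqs" "b \<in> finite_seqs"
  shows "val \<beta> (\<lambda>n. a n + b n) = val \<beta> a + val \<beta> b"
proof -
  obtain N where N: "\<And>n. n \<ge> N \<Longrightarrow> a n = 0"
    using finite_seqs_bound[OF assms(1)] by blast
  obtain M where M: "\<And>n. n \<ge> M \<Longrightarrow> b n = 0"
    using finite_seqs_bound[OF assms(2)] by blast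
  have "val \<beta> a = (\<Sum>n<max N M. real_of_int (a n) / (\<Prod>i\<le>n. \<beta> i))"
    using N by (intro val_eq_sum) auto
  moreover have "val \<beta> b = (\<Sum>n<max N M. real_of_int (b n) / (\<Prod>i\<le>n. \<beta> i))"
    using M by (intro val_eq_sum) auto
  moreover have "val \<beta> (\<lambda>n. a n + b n)
      = (\<Sum>n<max N M. real_of_int (a n + b n) / (\<Prod>i\<le>n. \<beta> i))"
    using N M by (intro val_eq_sum) auto
  ultimately show ?thesis
    by (simp add: sum.distrib add_divide_distrib)
qed

lemma val_nonneg:
  assumes "c \<in> finite_seqs" "\<forall>n. \<beta> n > 0"
  shows "val \<beta> c \<ge> 0"
proof -
  obtain N where "\<And>n. n \<ge> N \<Longrightarrow> c n = 0"
    using finite_seqs_bound[OF assms(1)] by blast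
  then show ?thesis
    using assms by (subst val_eq_sum[of N])
      (auto intro!: sum_nonneg divide_nonneg_nonneg prod_nonneg
            simp: finite_seqs_nonneg less_imp_le)
qed

text \<open>This recurrence has the same shape as that for the remainders of the greedy algorithm, so
  that values of tails and remainders can be compared position by position.\<close>

lemma val_step:
  assumes "c \<in> finite_seqs" "\<beta> 0 \<noteq> 0"
  shows "\<beta> 0 * val \<beta> c = of_int (c 0) + val (shift 1 \<beta>) (shift 1 c)"
proof -
  obtain N where N: "\<And>n. n \<ge> N \<Longrightarrow> c n = 0"
    using finite_seqs_bound[OF assms(1)] by blast
  have "val \<beta> c = (\<Sum>n<Suc N. real_of_int (c n) / (\<Prod>i\<le>n. \<beta> i))"
    using N by (intro val_eq_sum) auto
  also have "\<dots> = of_int (c 0) / \<beta> 0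
      + (\<Sum>n<N. real_of_int (c (Suc n)) / (\<beta> 0 * (\<Prod>i\<le>n. \<beta> (Suc i))))"
    by (simp only: sum.lessThan_Suc_shift prod.atMost_Suc_shift) simp
  finally have "\<beta> 0 * val \<beta> c = of_int (c 0)
      + (\<Sum>n<N. real_of_int (c (Suc n)) / (\<Prod>i\<le>n. \<beta> (Suc i)))"
    using assms(2) by (simp add: distrib_left sum_distrib_left)
  moreover have "val (shift 1 \<beta>) (shift 1 c)
      = (\<Sum>n<N. real_of_int (c (Suc n)) / (\<Prod>i\<le>n. \<beta> (Suc i)))"
    using N by (subst val_eq_sum[of N]) (auto simp: shift_def)
  ultimately show ?thesis
    by simp
qed

definition tail_val :: "(nat \<Rightarrow> real) \<Rightarrow> (nat \<Rightarrow> int) \<Rightarrow> nat \<Rightarrow> real" where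
  "tail_val \<beta> c n = val (shift n \<beta>) (shift n c)"

lemma tail_val_step:
  assumes "c \<in> finite_seqs" "\<forall>n. \<beta> n > 0"
  shows "\<beta> n * tail_val \<beta> c n = of_int (c n) + tail_val \<beta> c (Suc n)"
  using val_step[OF finite_seqs_shift[OF assms(1)], of "shift n \<beta>"] assms(2)[rule_format, of n]
  by (simp add: tail_val_def shift_shift) (simp add: shift_def)

lemma tail_val_nonneg:
  assumes "c \<in> finite_seqs" "\<forall>n. \<beta> n > 0"
  shows "tail_val \<beta> c n \<ge> 0"
  unfolding tail_val_def
  using assms by (intro val_nonneg finite_seqs_shift) (auto simp: shift_def)

lemma val_prepend_zeros:
  assumes "c \<in> finite_seqs" "\<forall>n. \<beta> n > 0"
  shows "(\<Prod>i<m. \<beta> i) * val \<beta> (prepend_zeros m c) = val (shift m \<beta>) c"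
proof -
  let ?v = "tail_val \<beta> (prepend_zeros m c)"
  have "(\<Prod>i<n. \<beta> i) * ?v 0 = ?v n" if "n \<le> m" for n
    using that
  proof (induction n)
    case (Suc n)
    have "\<beta> n * ?v n = ?v (Suc n)"
      using tail_val_step[OF finite_seqs_prepend_zeros[OF assms(1)] assms(2), where n = n] Suc.prems
      by (simp add: prepend_zeros_def)
    then show ?case
      using Suc by (simp add: mult_ac)
  qed simp
  from this[of m] show ?thesis
    by (simp add: tail_val_def shift_prepend_zeros)
qed

section \<open>The greedy algorithm\<close>

lemma remainder_Suc_shift:
  "remainder \<beta> x (Suc n) = remainder (shift 1 \<beta>) (\<beta> 0 * x - of_int \<lfloor>\<beta> 0 * x\<rfloor>) n"
  by (induction n) (auto simp: shift_def)

lemma remainder_Suc_bounds: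
  "0 \<le> remainder \<beta> x (Suc n)" "remainder \<beta> x (Suc n) < 1"
  by (simp_all, linarith+)

text \<open>While the digits vanish, the remainders grow at least geometrically, because the finitely
  many distinct terms of the base are bounded away from 1; they stay below 1, so they are 0.\<close>

lemma finite_expansion_imp_remainder_0:
  assumes "alternate_base p \<beta>" "expansion \<beta> x \<in> finite_seqs"
  shows "\<exists>M. remainder \<beta> x M = 0"
proof -
  obtain N where N: "\<And>n. n \<ge> N \<Longrightarrow> expansion \<beta> x n = 0"
    using finite_seqs_bound[OF assms(2)] by blast
  have p: "p \<ge> 1" and gt1: "\<And>n. \<beta> n > 1" and per: "\<And>n. \<beta> (n + p) = \<beta> n"
    using assms(1) by (auto simp: alternate_base_def)
  have per': "\<beta> (n + k * p) = \<beta> n" for n k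
  proof (induction k)
    case (Suc k)
    then show ?case
      using per[of "n + k * p"] by (simp add: algebra_simps)
  qed simp
  have mod: "\<beta> n = \<beta> (n mod p)" for n
    using per'[of "n mod p" "n div p"] by simp
  define b where "b = Min (\<beta> ` {..<p})"
  have ne: "\<beta> ` {..<p} \<noteq> {}"
    using p by (auto simp: lessThan_empty_iff)
  have "b > 1"
    unfolding b_def using ne gt1 by (subst Min_gr_iff) auto
  have b: "b \<le> \<beta> n" for n
    unfolding b_def by (subst mod) (use p in \<open>auto intro!: Min_le\<close>)
  let ?r = "remainder \<beta> x"
  have grow: "b ^ j * ?r (Suc N) \<le> ?r (Suc N + j)" for j
  proof (induction j)
    case (Suc j)
    have "expansion \<beta> x (Suc N + j) = 0"
      by (rule N) simp
    then have "?r (Suc (Suc N + j)) = \<beta> (Suc N + j) * ?r (Suc N + j)"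
      by (simp add: expansion_def)
    moreover have "b * ?r (Suc N + j) \<le> \<beta> (Suc N + j) * ?r (Suc N + j)"
      using b remainder_Suc_bounds(1)[of \<beta> x "N + j"] by (intro mult_right_mono) auto
    moreover have "b * (b ^ j * ?r (Suc N)) \<le> b * ?r (Suc N + j)"
      using Suc \<open>b > 1\<close> by (intro mult_left_mono) auto
    ultimately show ?case
      by (simp only: add_Suc_right power_Suc mult.assoc)
  qed simp
  have "?r (Suc N) = 0"
  proof (rule ccontr)
    assume "?r (Suc N) \<noteq> 0"
    then have pos: "?r (Suc N) > 0"
      using remainder_Suc_bounds(1)[of \<beta> x N] by linarith
    obtain j where "1 / ?r (Suc N) < b ^ j"
      using real_arch_pow[OF \<open>b > 1\<close>] by blast
    then have "1 < b ^ j * ?r (Suc N)"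
      using pos by (simp only: pos_divide_less_eq)
    then show False
      using grow[of j] remainder_Suc_bounds(2)[of \<beta> x "N + j"] by simp
  qed
  then show ?thesis
    by blast
qed

text \<open>If all tails have value below 1, the tail values are the remainders that the greedy
  algorithm produces.\<close>

lemma expansion_val:
  assumes "c \<in> finite_seqs" "\<forall>n. \<beta> n > 0" "\<And>n. tail_val \<beta> c n < 1"
  shows "expansion \<beta> (val \<beta> c) = c"
proof -
  have fl: "\<lfloor>\<beta> n * tail_val \<beta> c n\<rfloor> = c n" for n
    using tail_val_step[OF assms(1,2), of n] assms(3)[of "Suc n"]
      tail_val_nonneg[OF assms(1,2), of "Suc n"]
    by (simp add: floor_eq_iff)
  have "remainder \<beta> (val \<beta> c) n = tail_val \<beta> c n" for n
  proof (induction n)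
    case (Suc n)
    then show ?case
      using fl[of n] tail_val_step[OF assms(1,2), of n] by simp
  qed (simp add: tail_val_def)
  then show ?thesis
    using fl by (simp add: expansion_def)
qed

section \<open>Sums and differences of representable numbers\<close>

definition representable :: "(nat \<Rightarrow> real) \<Rightarrow> real \<Rightarrow> bool" where
  "representable \<beta> x \<longleftrightarrow> (\<exists>c\<in>finite_seqs. val \<beta> c = x)"

lemma representable_add:
  "representable \<beta> x \<Longrightarrow> representable \<beta> y \<Longrightarrow> representable \<beta> (x + y)"
  unfolding representable_def using finite_seqs_add val_add by metis

lemma representable_0: "representable \<beta> 0"
  unfolding representable_def
  by (rule bexI[of _ "\<lambda>_. 0"]) (auto simp: val_def finite_seqs_def)

lemma representable_step:
  assumes "representable (shift 1 \<beta>) r" "d \<ge> 0" "\<beta> 0 \<noteq> 0"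
  shows "representable \<beta> ((of_int d + r) / \<beta> 0)"
proof -
  obtain c where c: "c \<in> finite_seqs" "val (shift 1 \<beta>) c = r"
    using assms(1) by (auto simp: representable_def)
  obtain N where N: "\<And>n. n \<ge> N \<Longrightarrow> c n = 0"
    using finite_seqs_bound[OF c(1)] by blast
  define e where "e = (\<lambda>n. if n = 0 then d else c (n - 1))"
  have e: "e \<in> finite_seqs"
    using N assms(2) finite_seqs_nonneg[OF c(1)]
    by (intro finite_seqsI[of _ "Suc N"]) (auto simp: e_def)
  have "shift 1 e = c" "e 0 = d"
    by (auto simp: e_def shift_def)
  then have "val \<beta> e = (of_int d + r) / \<beta> 0"
    using val_step[of e \<beta>] e assms(3) c(2) by (simp add: field_simps)
  then show ?thesis
    using e by (auto simp: representable_def)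
qed

lemma remainder_0_imp_representable:
  assumes "\<forall>n. \<beta> n > 0" "x \<ge> 0" "remainder \<beta> x M = 0"
  shows "representable \<beta> x"
  using assms
proof (induction M arbitrary: \<beta> x)
  case 0
  then show ?case
    by (simp add: representable_0)
next
  case (Suc M)
  let ?d = "\<lfloor>\<beta> 0 * x\<rfloor>" and ?r = "\<beta> 0 * x - of_int \<lfloor>\<beta> 0 * x\<rfloor>"
  have pos: "\<beta> 0 > 0"
    using Suc.prems(1) by simp
  have "representable (shift 1 \<beta>) ?r"
    using Suc.prems remainder_Suc_shift[of \<beta> x M]
    by (intro Suc.IH) (auto simp: shift_def)
  then have "representable \<beta> ((of_int ?d + ?r) / \<beta> 0)"
    using pos Suc.prems(2) by (intro representable_step) auto
  then show ?case
    using pos by simp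
qed

text \<open>Subtraction proceeds digit by digit. If the leading digits \<open>d\<close> of \<open>u\<close> and \<open>e\<close> of \<open>v\<close>
  agree, one passes to the remainders \<open>u'\<close> and \<open>v'\<close>. If \<open>d > e\<close>, one unit is
  borrowed, \<open>\<beta> 0 * (u - v) = (d - e - 1) + u' + (1 - v')\<close>, and the difference \<open>1 - v'\<close> is
  again of the form treated, in the shifted base, because the expansion of 1 in that base is finite.\<close>

lemma representable_diff:
  assumes "\<forall>n. \<beta> n > 0" "\<forall>l. \<exists>K. remainder (shift l \<beta>) 1 K = 0"
    and "remainder \<beta> u K = 0" "remainder \<beta> v M = 0" "0 \<le> v" "v \<le> u"
  shows "representable \<beta> (u - v)"
  using assms
proof (induction M arbitrary: \<beta> u v K)
  case 0
  then show ?case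
    using remainder_0_imp_representable[of \<beta> u K] by simp
next
  case (Suc M)
  have pos: "\<beta> 0 > 0" and pos': "\<forall>n. shift 1 \<beta> n > 0"
    using Suc.prems(1) by (auto simp: shift_def)
  define d where "d = \<lfloor>\<beta> 0 * u\<rfloor>"
  define e where "e = \<lfloor>\<beta> 0 * v\<rfloor>"
  define u' where "u' = \<beta> 0 * u - of_int d"
  define v' where "v' = \<beta> 0 * v - of_int e"
  have one: "\<forall>l. \<exists>K. remainder (shift l (shift 1 \<beta>)) 1 K = 0"
    using Suc.prems(2) by (simp add: shift_shift)
  have u': "0 \<le> u'" and v': "0 \<le> v'" "v' < 1"
    by (simp_all add: u'_def v'_def d_def e_def, linarith+)
  have ru: "\<exists>K'. remainder (shift 1 \<beta>) u' K' = 0"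
  proof (cases K)
    case 0
    then have "u' = 0"
      using Suc.prems(3) by (simp add: u'_def d_def)
    then show ?thesis
      by (intro exI[of _ 0]) simp
  next
    case (Suc K')
    then show ?thesis
      using Suc.prems(3) remainder_Suc_shift[of \<beta> u K'] unfolding u'_def d_def by metis
  qed
  then obtain K' where K': "remainder (shift 1 \<beta>) u' K' = 0"
    by blast
  have rv: "remainder (shift 1 \<beta>) v' M = 0"
    using Suc.prems(4) remainder_Suc_shift[of \<beta> v M] unfolding v'_def e_def by metis
  have "e \<le> d"
    unfolding d_def e_def using Suc.prems(6) pos by (intro floor_mono) simp
  then consider "e = d" | "e < d"
    by linarith
  then show ?case
  proof cases
    case 1
    have "v' \<le> u'"
      unfolding u'_def v'_def 1 using Suc.prems(6) pos by simp
    then have "representable (shift 1 \<beta>) (u' - v')"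
      using Suc.IH[OF pos' one K' rv] v' by simp
    then have "representable \<beta> ((of_int 0 + (u' - v')) / \<beta> 0)"
      using pos by (intro representable_step) auto
    moreover have "(of_int 0 + (u' - v')) / \<beta> 0 = u - v"
      using pos 1 by (simp add: u'_def v'_def field_simps)
    ultimately show ?thesis
      by simp
  next
    case 2
    obtain L where "remainder (shift 1 \<beta>) 1 L = 0"
      using Suc.prems(2) by blast
    then have "representable (shift 1 \<beta>) (1 - v')"
      using Suc.IH[OF pos' one _ rv] v' by simp
    moreover have "representable (shift 1 \<beta>) u'"
      using remainder_0_imp_representable[OF pos' u' K'] .
    ultimately have "representable \<beta> ((of_int (d - e - 1) + (u' + (1 - v'))) / \<beta> 0)"
      using pos 2 by (intro representable_step representable_add) auto
    moreover have "(of_int (d - e - 1) + (u' + (1 - v'))) / \<beta> 0 = u - v"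
      using pos by (simp add: u'_def v'_def field_simps)
    ultimately show ?thesis
      by simp
  qed
qed

section \<open>Weights and lexicographically maximal sequences\<close>

lemma weight_eq_sum:
  assumes "\<And>n. n \<ge> N \<Longrightarrow> a n = 0"
  shows "weight w a = (\<Sum>n<N. int (w n) * a n)"
proof -
  have "{n. a n \<noteq> 0} \<subseteq> {..<N}"
    using assms not_le_imp_less by blast
  then show ?thesis
    unfolding weight_def by (intro sum.mono_neutral_left) auto
qed

lemma weight_add:
  assumes "a \<in> finite_seqs" "b \<in> finite_seqs"
  shows "weight w (\<lambda>n. a n + b n) = weight w a + weight w b"
proof -
  obtain N where N: "\<And>n. n \<ge> N \<Longrightarrow> a n = 0"
    using finite_seqs_bound[OF assms(1)] by blast
  obtain M where M: "\<And>n. n \<ge> M \<Longrightarrow> b n = 0"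
    using finite_seqs_bound[OF assms(2)] by blast
  have "weight w a = (\<Sum>n<max N M. int (w n) * a n)"
    using N by (intro weight_eq_sum) auto
  moreover have "weight w b = (\<Sum>n<max N M. int (w n) * b n)"
    using M by (intro weight_eq_sum) auto
  moreover have "weight w (\<lambda>n. a n + b n) = (\<Sum>n<max N M. int (w n) * (a n + b n))"
    using N M by (intro weight_eq_sum) auto
  ultimately show ?thesis
    by (simp add: sum.distrib distrib_left)
qed

lemma weight_remove_digit:
  assumes "a \<in> finite_seqs"
  shows "weight w a = weight w (a(m := 0)) + int (w m) * a m"
proof -
  obtain N where N: "\<And>n. n \<ge> N \<Longrightarrow> a n = 0"
    using finite_seqs_bound[OF assms] by blast
  let ?K = "max N (Suc m)"
  have "weight w a = (\<Sum>n<?K. int (w n) * a n)"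
    using N by (intro weight_eq_sum) auto
  also have "\<dots> = int (w m) * a m + (\<Sum>n\<in>{..<?K} - {m}. int (w n) * a n)"
    by (subst sum.remove[of _ m]) auto
  also have "(\<Sum>n\<in>{..<?K} - {m}. int (w n) * a n)
      = (\<Sum>n\<in>{..<?K} - {m}. int (w n) * (a(m := 0)) n)"
    by (intro sum.cong) auto
  also have "\<dots> = (\<Sum>n<?K. int (w n) * (a(m := 0)) n)"
    by (subst (2) sum.remove[of _ m]) auto
  also have "\<dots> = weight w (a(m := 0))"
    using N by (intro weight_eq_sum[symmetric]) auto
  finally show ?thesis
    by simp
qed

lemma weight_nonneg: "a \<in> finite_seqs \<Longrightarrow> weight w a \<ge> 0"
  unfolding weight_def by (intro sum_nonneg) (auto simp: finite_seqs_nonneg)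

lemma finite_seqs_remove_digit:
  assumes "a \<in> finite_seqs"
  shows "a(m := 0) \<in> finite_seqs"
proof -
  obtain N where "\<And>n. n \<ge> N \<Longrightarrow> a n = 0"
    using finite_seqs_bound[OF assms] by blast
  then show ?thesis
    using assms by (intro finite_seqsI[of _ N]) (auto simp: finite_seqs_nonneg)
qed

text \<open>Every sequence of successive rewritings terminates for this reason. The digits are bounded
  by the weight, so among the sequences that occupy the first position occupied at all some have
  the largest digit there. Removing this digit strictly lowers the weight, and induction gives a
  maximal remaining part.\<close>

lemma bounded_weight_has_lex_maximal:
  assumes "A \<noteq> {}" "A \<subseteq> finite_seqs" "\<And>n. w n > 0" "\<And>a. a \<in> A \<Longrightarrow> weight w a \<le> int N"
  shows "\<exists>a\<in>A. \<forall>c\<in>A. \<not> less_fun a c"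
  using assms
proof (induction N arbitrary: A rule: less_induct)
  case (less N)
  show ?case
  proof (cases "\<exists>m. \<exists>a\<in>A. a m \<noteq> 0")
    case False
    then have zero: "a m = 0" if "a \<in> A" for a m
      using that by blast
    obtain a where "a \<in> A"
      using less.prems(1) by blast
    moreover have "\<not> less_fun a c" if "c \<in> A" for c
      using zero[OF \<open>a \<in> A\<close>] zero[OF that] by (simp add: less_fun_def)
    ultimately show ?thesis
      by blast
  next
    case True
    define m where "m = (LEAST m. \<exists>a\<in>A. a m \<noteq> 0)"
    have ex: "\<exists>a\<in>A. a m \<noteq> 0"
      unfolding m_def using True by (rule LeastI_ex)
    have before: "a n = 0" if "a \<in> A" "n < m" for a n
      using not_less_Least[of n "\<lambda>m. \<exists>a\<in>A. a m \<noteq> 0"] that unfolding m_def by blast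
    have digit: "0 \<le> a m" "a m \<le> int N" if "a \<in> A" for a
    proof -
      have a: "a \<in> finite_seqs"
        using that less.prems(2) by blast
      show "0 \<le> a m"
        using a by (rule finite_seqs_nonneg)
      then have "a m \<le> int (w m) * a m"
        using less.prems(3)[of m] mult_right_mono[of 1 "int (w m)" "a m"] by simp
      also have "\<dots> \<le> weight w a"
        using weight_remove_digit[OF a, of w m] weight_nonneg[OF finite_seqs_remove_digit[OF a]]
        by simp
      finally show "a m \<le> int N"
        using less.prems(4)[OF that] by linarith
    qed
    define d where "d = Max ((\<lambda>a. a m) ` A)"
    have fin: "finite ((\<lambda>a. a m) ` A)"
      by (rule finite_subset[of _ "{0..int N}"]) (use digit in auto)
    have d_in: "d \<in> (\<lambda>a. a m) ` A"
      unfolding d_def using fin less.prems(1) by (intro Max_in) auto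
    have d_ge: "a m \<le> d" if "a \<in> A" for a
      unfolding d_def using fin that by (intro Max_ge) auto
    have "d > 0"
    proof -
      obtain a where "a \<in> A" "a m \<noteq> 0"
        using ex by blast
      then show ?thesis
        using digit(1)[of a] d_ge[of a] by linarith
    qed
    let ?A = "(\<lambda>a. a(m := 0)) ` {a \<in> A. a m = d}"
    have small: "weight w a \<le> int N - 1" if a: "a \<in> ?A" for a
    proof -
      obtain a' where a': "a' \<in> A" "a' m = d" "a = a'(m := 0)"
        using a by blast
      have "1 \<le> int (w m) * d"
        using less.prems(3)[of m] \<open>d > 0\<close> by (simp add: int_one_le_iff_zero_less)
      then show ?thesis
        using weight_remove_digit[of a' w m] a' less.prems(2,4) by force
    qed
    have sub: "?A \<subseteq> finite_seqs"
      using less.prems(2) finite_seqs_remove_digit by blast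
    have ne: "?A \<noteq> {}"
      using d_in by auto
    have "N > 0"
    proof -
      obtain a where "a \<in> ?A"
        using ne by blast
      then show ?thesis
        using small[of a] weight_nonneg[of a w] sub by force
    qed
    then have "\<exists>a\<in>?A. \<forall>c\<in>?A. \<not> less_fun a c"
      using small by (intro less.IH[of "N - 1"] ne sub less.prems(3)) (auto simp: of_nat_diff)
    then obtain a where a: "a \<in> A" "a m = d"
      and a_max: "\<And>c. c \<in> ?A \<Longrightarrow> \<not> less_fun (a(m := 0)) c"
      by blast
    have "\<not> less_fun a c" if "c \<in> A" for c
    proof
      assume "less_fun a c"
      then obtain k where k: "a k < c k" "\<And>j. j < k \<Longrightarrow> a j = c j"
        unfolding less_fun_def by blast
      have "\<not> k < m"
        using k(1) before[OF a(1), of k] before[OF that, of k] by linarith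
      moreover have "k \<noteq> m"
        using k(1) a(2) d_ge[OF that] by auto
      ultimately have "m < k"
        by linarith
      have "c m = d"
        using k(2)[OF \<open>m < k\<close>] a(2) by simp
      then have "c(m := 0) \<in> ?A"
        using that by blast
      moreover have "less_fun (a(m := 0)) (c(m := 0))"
        unfolding less_fun_def using k \<open>m < k\<close> by (intro exI[of _ k]) simp
      ultimately show False
        using a_max by blast
    qed
    then show ?thesis
      using a(1) by blast
  qed
qed

section \<open>Rewriting\<close>

text \<open>As long as the digits agree, the tail values stay at or above the remainders of 1; a smaller
  digit would have to be compensated by a later tail of value at least 1.\<close>

lemma tail_ge_expansion_one:
  assumes b: "b \<in> finite_seqs" and pos: "\<forall>n. \<beta> n > 0"
    and ge: "tail_val \<beta> b n \<ge> 1" and lt: "\<And>m. m > n \<Longrightarrow> tail_val \<beta> b m < 1"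
  shows "shift n b = expansion_one \<beta> n \<or>
    (\<exists>k. (\<forall>i<k. b (n + i) = expansion_one \<beta> n i) \<and> b (n + k) > expansion_one \<beta> n k)"
proof (rule ccontr)
  let ?t = "expansion_one \<beta> n" and ?r = "remainder (shift n \<beta>) 1"
  assume neg: "\<not> ?thesis"
  have r_step: "\<beta> (n + k) * ?r k = of_int (?t k) + ?r (Suc k)" for k
    by (simp add: expansion_one_def expansion_def shift_def)
  have agree: "(\<forall>i<k. b (n + i) = ?t i) \<and> ?r k \<le> tail_val \<beta> b (n + k)" for k
  proof (induction k)
    case 0
    then show ?case
      using ge by simp
  next
    case (Suc k)
    have le: "\<beta> (n + k) * ?r k \<le> \<beta> (n + k) * tail_val \<beta> b (n + k)"
      using Suc pos by (intro mult_left_mono) (auto simp: less_imp_le)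
    have v: "\<beta> (n + k) * tail_val \<beta> b (n + k)
        = of_int (b (n + k)) + tail_val \<beta> b (Suc (n + k))"
      using tail_val_step[OF b pos] .
    have "of_int (?t k) < real_of_int (b (n + k)) + 1"
      using le v r_step[of k] lt[of "Suc (n + k)"] remainder_Suc_bounds(1)[of "shift n \<beta>" 1 k]
      by linarith
    then have "?t k \<le> b (n + k)"
      by linarith
    moreover have "\<not> ?t k < b (n + k)"
      using neg Suc by blast
    ultimately have "b (n + k) = ?t k"
      by simp
    moreover from this have "?r (Suc k) \<le> tail_val \<beta> b (n + Suc k)"
      using le v r_step[of k] by (simp del: remainder.simps)
    ultimately show ?case
      using Suc by (auto simp: less_Suc_eq)
  qed
  then have "shift n b = ?t"
    by (auto simp: shift_def fun_eq_iff)
  then show False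
    using neg by blast
qed

lemma shift_periodic:
  assumes "\<And>n. \<beta> (n + p) = (\<beta> n :: real)"
  shows "shift (q * p + l) \<beta> = shift l \<beta>"
proof (induction q)
  case (Suc q)
  have "shift (Suc q * p + l) \<beta> n = shift (q * p + l) \<beta> n" for n
    using assms[of "q * p + l + n"] by (simp add: shift_def add_ac)
  then show ?case
    using Suc by auto
qed simp

lemma weight_prepend_zeros_mult:
  assumes "\<And>a. a \<in> finite_seqs \<Longrightarrow> weight w (prepend_zeros p a) = weight w a" "a \<in> finite_seqs"
  shows "weight w (prepend_zeros (q * p) a) = weight w a"
proof (induction q)
  case (Suc q)
  then show ?case
    using assms(1)[OF finite_seqs_prepend_zeros[OF assms(2), of "q * p"]]
    by (simp add: prepend_zeros_add)
qed simp

text \<open>The last tail of value at least 1 dominates, digit by digit, what follows the leading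
  \<open>p + l\<close> zeros of some rewritable string. Subtracting that string, moved into place
  by whole periods, leaves nonnegative digits, and its rewriting can be added instead. Moving by whole periods is
  harmless: it scales both values by the same factor and preserves both weights.\<close>

lemma rewriting_step:
  assumes base: "alternate_base p \<beta>" and T: "rewriting p \<beta> T"
    and w0: "\<And>a. a \<in> finite_seqs \<Longrightarrow> weight w (prepend_zeros p a) = weight w a"
    and wT: "\<And>a. a \<in> rewritable p \<beta> \<Longrightarrow> weight w (T a) \<le> weight w a"
    and b: "b \<in> finite_seqs" and n: "n \<ge> p" and ge: "tail_val \<beta> b n \<ge> 1"
  shows "\<exists>c\<in>finite_seqs. val \<beta> c = val \<beta> b \<and> weight w c \<le> weight w b \<and> less_fun b c"
proof -
  have p: "p \<ge> 1" and pos: "\<forall>n. \<beta> n > 0" and per: "\<And>n. \<beta> (n + p) = \<beta> n"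
    using base by (auto simp: alternate_base_def intro: less_trans[OF zero_less_one])
  \<comment> \<open>The last such position is taken: all tails after it are below 1.\<close>
  obtain n where n: "n \<ge> p" and ge: "tail_val \<beta> b n \<ge> 1"
    and lt: "\<And>m. m > n \<Longrightarrow> tail_val \<beta> b m < 1"
  proof -
    obtain N where N: "\<And>n. n \<ge> N \<Longrightarrow> b n = 0"
      using finite_seqs_bound[OF b] by blast
    have zero: "tail_val \<beta> b m = 0" if "m \<ge> N" for m
      using that N by (simp add: tail_val_def val_def shift_def)
    let ?P = "\<lambda>m. tail_val \<beta> b m \<ge> 1"
    have bd: "\<And>m. ?P m \<Longrightarrow> m \<le> N"
      using zero by (metis nle_le not_one_le_zero)
    let ?n = "GREATEST m. ?P m"
    have "?P ?n" "n \<le> ?n"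
      using GreatestI_nat[of ?P n N] Greatest_le_nat[of ?P n N] ge bd by auto
    moreover have "tail_val \<beta> b m < 1" if "m > ?n" for m
      using Greatest_le_nat[of ?P m N] bd that by force
    ultimately show ?thesis
      using that[of ?n] n le_trans by blast
  qed
  \<comment> \<open>Rewritable strings start with \<open>p + l\<close> zeros, hence one period less in front.\<close>
  define l where "l = n mod p"
  define q where "q = n div p - 1"
  have "n div p \<ge> 1"
    using n p by (simp add: div_greater_zero_iff Suc_le_eq)
  then have "n = Suc q * p + l"
    unfolding q_def l_def by (simp add: div_mult_mod_eq)
  then have n_eq: "n = q * p + (p + l)"
    by simp
  have l: "l < p"
    using p by (simp add: l_def)
  have "shift n \<beta> = shift l \<beta>"
    using shift_periodic[of \<beta> p "Suc q" l] per \<open>n = Suc q * p + l\<close> by simp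
  then have tl: "expansion_one \<beta> n = expansion_one \<beta> l"
    by (simp add: expansion_one_def)
  let ?t = "expansion_one \<beta> l"
  obtain s where s: "s \<in> rewritable p \<beta>" "s \<in> finite_seqs"
    and s_le: "\<And>j. prepend_zeros (q * p) s j \<le> b j"
  proof -
    have t_nonneg: "?t i \<ge> 0" for i
    proof -
      have "remainder (shift l \<beta>) 1 i \<ge> 0"
        using remainder_Suc_bounds(1)[of "shift l \<beta>" 1] by (cases i) simp_all
      then show ?thesis
        using pos by (simp add: expansion_one_def expansion_def shift_def less_imp_le)
    qed
    consider (eq) "shift n b = ?t"
      | (gt) k where "\<And>i. i < k \<Longrightarrow> b (n + i) = ?t i" "b (n + k) > ?t k"
      using tail_ge_expansion_one[OF b pos ge lt] unfolding tl by blast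
    then show ?thesis
    proof cases
      case eq
      let ?s = "prepend_zeros (p + l) ?t"
      have fin: "?s \<in> finite_seqs"
        using finite_seqs_shift[OF b, of n] eq by (intro finite_seqs_prepend_zeros) simp
      moreover have "?s \<in> rewritable p \<beta>"
        using l fin by (auto simp: rewritable_def)
      moreover have "prepend_zeros (q * p) ?s j \<le> b j" for j
      proof (cases "j < n")
        case True
        then show ?thesis
          using finite_seqs_nonneg[OF b, of j]
          by (simp add: prepend_zeros_add n_eq[symmetric]) (simp add: prepend_zeros_def)
      next
        case False
        then show ?thesis
          using fun_cong[OF eq, of "j - n"]
          by (simp add: prepend_zeros_add n_eq[symmetric]) (simp add: prepend_zeros_def shift_def)
      qed
      ultimately show ?thesis
        using that by blast
    next
      case gt
      let ?s = "prepend_zeros (p + l) (cut_incr k ?t)"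
      have "cut_incr k ?t \<in> finite_seqs"
        using t_nonneg by (intro finite_seqsI[of _ "Suc k"]) (auto simp: cut_incr_def add_nonneg_nonneg)
      then have "?s \<in> finite_seqs"
        by (rule finite_seqs_prepend_zeros)
      moreover have "?s \<in> rewritable p \<beta>"
        using l by (auto simp: rewritable_def)
      moreover have "prepend_zeros (q * p) ?s j \<le> b j" for j
      proof (cases "j < n")
        case True
        then show ?thesis
          using finite_seqs_nonneg[OF b, of j]
          by (simp add: prepend_zeros_add n_eq[symmetric]) (simp add: prepend_zeros_def)
      next
        case False
        then obtain i where "j = n + i"
          using le_Suc_ex not_less by metis
        then show ?thesis
          using gt(1)[of i] gt(2) finite_seqs_nonneg[OF b, of j]
          by (simp add: prepend_zeros_add n_eq[symmetric]) (simp add: prepend_zeros_def cut_incr_def)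
      qed
      ultimately show ?thesis
        using that by blast
    qed
  qed
  have Ts: "T s \<in> finite_seqs" "val \<beta> (T s) = val \<beta> s" "less_fun s (T s)"
    using T s(1) by (auto simp: rewriting_def)
  let ?s = "prepend_zeros (q * p) s" and ?Ts = "prepend_zeros (q * p) (T s)"
  define b' where "b' = (\<lambda>n. b n - ?s n)"
  define c where "c = (\<lambda>n. b' n + ?Ts n)"
  have b': "b' \<in> finite_seqs"
    unfolding b'_def using s_le by (intro finite_seqs_diff b finite_seqs_prepend_zeros s(2))
  have b_eq: "b = (\<lambda>n. b' n + ?s n)"
    by (simp add: b'_def)
  have fs: "?s \<in> finite_seqs" "?Ts \<in> finite_seqs"
    using s(2) Ts(1) finite_seqs_prepend_zeros by blast+
  have sh: "shift (q * p) \<beta> = \<beta>"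
    using shift_periodic[of \<beta> p q 0] per by simp
  have "val \<beta> ?Ts = val \<beta> ?s"
  proof -
    have "(\<Prod>i<q * p. \<beta> i) > 0"
      using pos by (intro prod_pos) auto
    then show ?thesis
      using val_prepend_zeros[OF s(2) pos, of "q * p"] val_prepend_zeros[OF Ts(1) pos, of "q * p"]
        sh Ts(2) by (metis less_irrefl mult_left_cancel)
  qed
  then have "val \<beta> c = val \<beta> b"
    unfolding c_def by (subst b_eq) (simp add: val_add b' fs)
  moreover have "weight w c \<le> weight w b"
  proof -
    have "weight w ?Ts \<le> weight w ?s"
      using weight_prepend_zeros_mult[OF w0] wT[OF s(1)] s(2) Ts(1) by simp
    then show ?thesis
      using weight_add[OF b' fs(1), of w] weight_add[OF b' fs(2), of w]
      by (simp add: c_def b_eq[symmetric])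
  qed
  moreover have "less_fun b c"
  proof -
    obtain k where k: "s k < T s k" "\<And>j. j < k \<Longrightarrow> s j = T s j"
      using Ts(3) unfolding less_fun_def by blast
    have "b j = c j" if "j < q * p + k" for j
      using that k(2)[of "j - q * p"] by (auto simp: c_def b'_def prepend_zeros_def)
    moreover have "b (q * p + k) < c (q * p + k)"
      using k(1) by (simp add: c_def b'_def prepend_zeros_def)
    ultimately show ?thesis
      unfolding less_fun_def by blast
  qed
  moreover have "c \<in> finite_seqs"
    unfolding c_def by (intro finite_seqs_add b' fs)
  ultimately show ?thesis
    by blast
qed

text \<open>The representation is moved one period to the right, because a rewriting may need positions
  to the left of those it rewrites, and is replaced by a lexicographically maximal one of no larger
  weight. The first \<open>p\<close> digits of the latter still vanish, because one unit there would
  exceed the value. By maximality no later tail has value 1 or more, so what follows the first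
  period is greedy.\<close>

lemma representable_imp_Fin:
  assumes base: "alternate_base p \<beta>" and wp: "weight_property p \<beta>"
    and rep: "representable \<beta> z" and z: "z < 1"
  shows "z \<in> Fin \<beta>"
proof -
  have gt1: "\<And>n. \<beta> n > 1" and per: "\<And>n. \<beta> (n + p) = \<beta> n"
    using base by (auto simp: alternate_base_def)
  have pos: "\<forall>n. \<beta> n > 0"
    using gt1 by (meson less_trans zero_less_one)
  obtain T w where T: "rewriting p \<beta> T" and w: "\<And>n. w n > 0"
    and w0: "\<And>a. a \<in> finite_seqs \<Longrightarrow> weight w (prepend_zeros p a) = weight w a"
    and wT: "\<And>a. a \<in> rewritable p \<beta> \<Longrightarrow> weight w (T a) \<le> weight w a"
    using wp unfolding weight_property_def by blast
  obtain a where a: "a \<in> finite_seqs" "val \<beta> a = z"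
    using rep by (auto simp: representable_def)
  let ?a = "prepend_zeros p a"
  define A where "A = {b \<in> finite_seqs. val \<beta> b = val \<beta> ?a \<and> weight w b \<le> weight w ?a}"
  have fa: "?a \<in> finite_seqs"
    using finite_seqs_prepend_zeros[OF a(1)] .
  have "\<exists>b\<in>A. \<forall>c\<in>A. \<not> less_fun b c"
    using fa weight_nonneg[OF fa, of w]
    by (intro bounded_weight_has_lex_maximal[of A w "nat (weight w ?a)"] w) (auto simp: A_def)
  then obtain b where b: "b \<in> finite_seqs" "val \<beta> b = val \<beta> ?a" "weight w b \<le> weight w ?a"
    and b_max: "\<And>c. c \<in> A \<Longrightarrow> \<not> less_fun b c"
    by (auto simp: A_def)
  have lt: "tail_val \<beta> b n < 1" if "n \<ge> p" for n
  proof (rule ccontr)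
    assume "\<not> ?thesis"
    then have "tail_val \<beta> b n \<ge> 1"
      by simp
    from rewriting_step[OF base T w0 wT b(1) that this]
    obtain c where "c \<in> finite_seqs" "val \<beta> c = val \<beta> b" "weight w c \<le> weight w b" "less_fun b c"
      by blast
    then show False
      using b b_max[of c] by (simp add: A_def)
  qed
  have shp: "shift p \<beta> = \<beta>"
    using shift_periodic[of \<beta> p 1 0] per by simp
  have init: "tail_val \<beta> b i = (\<Prod>j<i. \<beta> j) * val \<beta> ?a" if "i \<le> p" for i
    using that
  proof (induction i)
    case 0
    then show ?case
      using b(2) by (simp add: tail_val_def)
  next
    case (Suc i)
    have "\<beta> i * tail_val \<beta> b i = (\<Prod>j<Suc i. \<beta> j) * val \<beta> ?a"
      using Suc by (simp add: mult_ac)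
    also have "\<dots> \<le> (\<Prod>j<p. \<beta> j) * val \<beta> ?a"
    proof (rule mult_right_mono)
      show "(\<Prod>j<Suc i. \<beta> j) \<le> (\<Prod>j<p. \<beta> j)"
        using Suc.prems pos gt1 by (intro prod_mono2) (auto simp: less_imp_le)
      show "val \<beta> ?a \<ge> 0"
        using val_nonneg[OF fa pos] .
    qed
    also have "\<dots> < 1"
      using val_prepend_zeros[OF a(1) pos, of p] shp a(2) z by simp
    finally have "\<beta> i * tail_val \<beta> b i < 1" .
    then have "b i = 0"
      using tail_val_step[OF b(1) pos, of i] tail_val_nonneg[OF b(1) pos, of "Suc i"]
        finite_seqs_nonneg[OF b(1), of i] by linarith
    then show ?case
      using tail_val_step[OF b(1) pos, of i] Suc by (simp add: mult_ac)
  qed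
  let ?c = "shift p b"
  have c: "?c \<in> finite_seqs"
    using finite_seqs_shift[OF b(1)] .
  have val_c: "val \<beta> ?c = z"
    using init[of p] val_prepend_zeros[OF a(1) pos, of p] shp a(2) by (simp add: tail_val_def)
  have "tail_val \<beta> ?c n < 1" for n
  proof -
    have "tail_val \<beta> b (p + n) = tail_val \<beta> ?c n"
      unfolding tail_val_def by (simp add: shift_shift[symmetric] shp)
    then show ?thesis
      using lt[of "p + n"] by simp
  qed
  then have "expansion \<beta> z = ?c"
    using expansion_val[OF c pos] val_c by metis
  moreover have "z \<ge> 0"
    using val_nonneg[OF a(1) pos] a(2) by simp
  ultimately show ?thesis
    using c z by (simp add: Fin_def)
qed

theorem theorem5p10:
  fixes \<beta> :: "nat \<Rightarrow> real" and p :: nat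
  assumes "alternate_base p \<beta>"
    and "simple_parry p \<beta>"
    and "weight_property p \<beta>"
  shows "property_F \<beta>"
proof -
  have p: "p \<ge> 1" and pos: "\<forall>n. \<beta> n > 0" and per: "\<And>n. \<beta> (n + p) = \<beta> n"
    using assms(1) by (auto simp: alternate_base_def intro: less_trans[OF zero_less_one])
  have one: "\<forall>l. \<exists>K. remainder (shift l \<beta>) 1 K = 0"
  proof
    fix l
    have "shift l \<beta> = shift (l mod p) \<beta>"
      using shift_periodic[of \<beta> p "l div p" "l mod p"] per by simp
    moreover have "expansion (shift (l mod p) \<beta>) 1 \<in> finite_seqs"
      using assms(2) p by (simp add: simple_parry_def expansion_one_def)
    moreover have "alternate_base p (shift l \<beta>)"
      using assms(1) by (simp add: alternate_base_def shift_def add.assoc[symmetric])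
    ultimately show "\<exists>K. remainder (shift l \<beta>) 1 K = 0"
      using finite_expansion_imp_remainder_0 by metis
  qed
  have fin: "\<exists>M. remainder \<beta> x M = 0" "x \<ge> 0" "representable \<beta> x" if "x \<in> Fin \<beta>" for x
  proof -
    show "\<exists>M. remainder \<beta> x M = 0" "x \<ge> 0"
      using that finite_expansion_imp_remainder_0[OF assms(1)] by (auto simp: Fin_def)
    then show "representable \<beta> x"
      using remainder_0_imp_representable[OF pos] by blast
  qed
  show ?thesis
    unfolding property_F_def
  proof (intro ballI conjI impI)
    fix x y
    assume xy: "x \<in> Fin \<beta>" "y \<in> Fin \<beta>"
    show "x + y \<in> Fin \<beta>" if "x + y \<in> {0..<1}"
      using that representable_add[OF fin(3)[OF xy(1)] fin(3)[OF xy(2)]]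
      by (intro representable_imp_Fin[OF assms(1,3)]) auto
    show "x - y \<in> Fin \<beta>" if "x - y \<in> {0..<1}"
    proof -
      obtain K M where "remainder \<beta> x K = 0" "remainder \<beta> y M = 0"
        using fin(1) xy by blast
      then have "representable \<beta> (x - y)"
        using representable_diff[OF pos one] fin(2)[OF xy(2)] that by simp
      then show ?thesis
        using that by (intro representable_imp_Fin[OF assms(1,3)]) auto
    qed
  qed
qed

end
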